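(* For every $\beta\ge 0$, the stationary expected social welfare of the logit dynamics with inverse noise $\beta$ for the CK game is $$\mathbf{E}_\pi[W] = -\frac{6+39e^{-4\beta}+63e^{-6\beta}}{1+3e^{-4\beta}+4e^{-6\beta}}.$$
   Context: Logit dynamics: for a strategic game with players $1,\dots,n$ (or any index set of size $n$), finite strategy sets $S_i$ and utilities $u_i:S_1\times\cdots\times S_n\to\mathbb{R}$, and for $\beta\ge 0$, let $\sigma_i(y\mid\mathbf{x})=e^{\beta u_i(\mathbf{x}_{-i},y)}/\sum_{z\in S_i}e^{\beta u_i(\mathbf{x}_{-i},z)}$, where $(\mathbf{x}_{-i},y)$ is $\mathbf{x}$ with its $i$-th entry replaced by $y$. The logit dynamics with inverse noise $\beta$ is the Markov chain on $\Omega=S_1\times\cdots\times S_n$ which, from profile $\mathbf{x}$, selects a player $i$ uniformly at random and replaces $x_i$ by $y\in S_i$ with probability $\sigma_i(y\mid\mathbf{x})$. It is irreducible and aperiodic; $\pi$ denotes its unique stationary distribution. The social welfare is $W(\mathbf{x})=\sum_i u_i(\mathbf{x})$ and the stationary expected social welfare is $\mathbf{E}_\pi[W]=\sum_{\mathbf{x}}W(\mathbf{x})\pi(\mathbf{x})$. The CK game: there are $3$ players, indexed by $i\in\{0,1,2\}$, and $6$ facilities $g_0,g_1,g_2,h_0,h_1,h_2$ (indices modulo $3$). Each player has strategies $0$ and $1$: with strategy $0$ player $i$ selects the facilities $g_i,h_i$; with strategy $1$ she selects the facilities $g_{i+1},h_{i-1},h_{i+1}$. In a profile, the cost of a facility is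 the number of players selecting it, and the utility of a player is minus the sum of the costs of the facilities she selects. *)

theory Defs
  imports "HOL-Probability.Probability"
begin

section \<open>Logit dynamics of a finite strategic game\<close>

text \<open>The players are the elements of a finite type \<open>'i\<close>, so the number of players is
  \<open>CARD('i)\<close>. Player \<open>i\<close> has the strategy set \<open>S i\<close> and the utility function \<open>u i\<close>.\<close>

definition profiles :: "('i::finite \<Rightarrow> 's set) \<Rightarrow> ('i \<Rightarrow> 's) set" where
  "profiles S = {x. \<forall>i. x i \<in> S i}"

definition logit_prob ::
  "('i::finite \<Rightarrow> 's set) \<Rightarrow> ('i \<Rightarrow> ('i \<Rightarrow> 's) \<Rightarrow> real) \<Rightarrow> real \<Rightarrow> 'i \<Rightarrow> ('i \<Rightarrow> 's) \<Rightarrow> 's \<Rightarrow> real"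
  where
  "logit_prob S u \<beta> i x y =
     exp (\<beta> * u i (x(i := y))) / (\<Sum>z\<in>S i. exp (\<beta> * u i (x(i := z))))"

text \<open>The next function is meaningful only if \<open>S i\<close> is finite and nonempty:
  see \<open>pmf_logit_choice\<close> below.\<close>

definition logit_choice ::
  "('i::finite \<Rightarrow> 's set) \<Rightarrow> ('i \<Rightarrow> ('i \<Rightarrow> 's) \<Rightarrow> real) \<Rightarrow> real \<Rightarrow> 'i \<Rightarrow> ('i \<Rightarrow> 's) \<Rightarrow> 's pmf"
  where
  "logit_choice S u \<beta> i x = embed_pmf (\<lambda>y. if y \<in> S i then logit_prob S u \<beta> i x y else 0)"

definition logit_step ::
  "('i::finite \<Rightarrow> 's set) \<Rightarrow> ('i \<Rightarrow> ('i \<Rightarrow> 's) \<Rightarrow> real) \<Rightarrow> real \<Rightarrow> ('i \<Rightarrow> 's) \<Rightarrow> ('i \<Rightarrow> 's) pmf"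
  where
  "logit_step S u \<beta> x =
     bind_pmf (pmf_of_set UNIV)
       (\<lambda>i. map_pmf (\<lambda>y. x(i := y)) (logit_choice S u \<beta> i x))"

definition stationary_distribution ::
  "'a set \<Rightarrow> ('a \<Rightarrow> 'a pmf) \<Rightarrow> 'a pmf \<Rightarrow> bool" where
  "stationary_distribution \<Omega> K p \<longleftrightarrow> set_pmf p \<subseteq> \<Omega> \<and> bind_pmf p K = p"

definition logit_stationary ::
  "('i::finite \<Rightarrow> 's set) \<Rightarrow> ('i \<Rightarrow> ('i \<Rightarrow> 's) \<Rightarrow> real) \<Rightarrow> real \<Rightarrow> ('i \<Rightarrow> 's) pmf" where
  "logit_stationary S u \<beta> =
     (THE p. stationary_distribution (profiles S) (logit_step S u \<beta>) p)"

definition social_welfare ::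
  "('i::finite \<Rightarrow> ('i \<Rightarrow> 's) \<Rightarrow> real) \<Rightarrow> ('i \<Rightarrow> 's) \<Rightarrow> real" where
  "social_welfare u x = (\<Sum>i\<in>UNIV. u i x)"

definition stationary_expected_welfare ::
  "('i::finite \<Rightarrow> 's set) \<Rightarrow> ('i \<Rightarrow> ('i \<Rightarrow> 's) \<Rightarrow> real) \<Rightarrow> real \<Rightarrow> real" where
  "stationary_expected_welfare S u \<beta> =
     measure_pmf.expectation (logit_stationary S u \<beta>) (social_welfare u)"

lemma pmf_logit_choice:
  assumes "finite (S i)" and "S i \<noteq> {}"
  shows "pmf (logit_choice S u \<beta> i x) y = (if y \<in> S i then logit_prob S u \<beta> i x y else 0)"
proof -
  let ?f = "\<lambda>y. if y \<in> S i then logit_prob S u \<beta> i x y else 0"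
  have pos: "(\<Sum>z\<in>S i. exp (\<beta> * u i (x(i := z)))) > 0"
    using assms by (intro sum_pos) auto
  have nonneg: "?f z \<ge> 0" for z
    using pos by (auto simp: logit_prob_def)
  have "(\<integral>\<^sup>+ z. ennreal (?f z) \<partial>count_space UNIV) = (\<Sum>z\<in>S i. ennreal (?f z))"
    using assms(1) by (intro nn_integral_count_space') auto
  also have "\<dots> = ennreal (\<Sum>z\<in>S i. ?f z)"
    by (rule sum_ennreal) (use nonneg in blast)
  also have "(\<Sum>z\<in>S i. ?f z) = 1"
    using pos by (simp add: logit_prob_def flip: sum_divide_distrib)
  finally show ?thesis
    unfolding logit_choice_def using nonneg by (subst pmf_embed_pmf) auto
qed


section \<open>The CK game\<close>

text \<open>Players and facility indices are taken in the numeral type \<open>3\<close>, whose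
  arithmetic is modulo 3, with elements 0, 1 and 2.\<close>

datatype facility = G 3 | H 3

definition ck_strategies :: "3 \<Rightarrow> nat set" where
  "ck_strategies i = {0, 1}"

text \<open>Only the strategies 0 and 1 are available, so the second branch is strategy 1.\<close>

definition ck_select :: "3 \<Rightarrow> nat \<Rightarrow> facility set" where
  "ck_select i s = (if s = 0 then {G i, H i} else {G (i + 1), H (i - 1), H (i + 1)})"

definition ck_cost :: "(3 \<Rightarrow> nat) \<Rightarrow> facility \<Rightarrow> nat" where
  "ck_cost x f = card {i. f \<in> ck_select i (x i)}"

definition ck_utility :: "3 \<Rightarrow> (3 \<Rightarrow> nat) \<Rightarrow> real" where
  "ck_utility i x = - (\<Sum>f\<in>ck_select i (x i). real (ck_cost x f))"

end

theory Submission
  imports Defs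
begin

text \<open>The CK game is a congestion game, hence has an exact (Rosenthal) potential \<open>\<Phi>\<close>. The logit
  dynamics of an exact potential game is reversible with respect to the Gibbs measure, whose
  weights are \<open>exp (\<beta> * \<Phi> x)\<close>, and the maximum principle shows that this is the only stationary
  distribution. With \<open>c f\<close> the cost of facility \<open>f\<close>, \<open>\<Phi>\<close> is minus the sum of \<open>c f * (c f + 1) / 2\<close>
  and the social welfare is minus the sum of the squares of \<open>c f\<close>, so that only the values of \<open>c\<close>
  on the eight profiles matter.\<close>

section \<open>Reversible kernels on a finite set\<close>

lemma pmf_bind_finite:
  assumes "finite \<Omega>" and "set_pmf p \<subseteq> \<Omega>"
  shows "pmf (bind_pmf p K) y = (\<Sum>x\<in>\<Omega>. pmf p x * pmf (K x) y)"
  using assms by (simp add: pmf_bind integral_measure_pmf_real[of \<Omega>] subset_iff mult.commute)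

lemma sum_pmf_mult_swap:
  assumes rev: "\<And>x. x \<in> \<Omega> \<Longrightarrow> pmf p x * pmf (K x) y = pmf p y * pmf (K y) x"
  shows "(\<Sum>x\<in>\<Omega>. pmf p x * pmf (K x) y) = pmf p y * (\<Sum>x\<in>\<Omega>. pmf (K y) x)"
  unfolding sum_distrib_left by (intro sum.cong refl rev)

text \<open>Detailed balance turns the inflow into \<open>y\<close> into the outflow from
  \<open>y\<close>. For \<open>y\<close> in \<Omega> this is all of its mass, as \<open>K y\<close>
  stays in \<Omega>; elsewhere \<open>p\<close> vanishes.\<close>

lemma reversible_imp_stationary:
  assumes fin: "finite \<Omega>" and p: "set_pmf p \<subseteq> \<Omega>"
    and closed: "\<And>x. x \<in> \<Omega> \<Longrightarrow> set_pmf (K x) \<subseteq> \<Omega>"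
    and rev: "\<And>x y. pmf p x * pmf (K x) y = pmf p y * pmf (K y) x"
  shows "stationary_distribution \<Omega> K p"
proof -
  have "pmf (bind_pmf p K) y = pmf p y" for y
  proof -
    have "pmf (bind_pmf p K) y = pmf p y * (\<Sum>x\<in>\<Omega>. pmf (K y) x)"
      unfolding pmf_bind_finite[OF fin p] by (rule sum_pmf_mult_swap) (rule rev)
    also have "\<dots> = pmf p y"
    proof (cases "y \<in> \<Omega>")
      case True
      then show ?thesis by (simp add: sum_pmf_eq_1[OF fin closed])
    next
      case False
      then have "pmf p y = 0" using p by (auto simp: pmf_eq_0_set_pmf)
      then show ?thesis by simp
    qed
    finally show ?thesis .
  qed
  then show ?thesis
    unfolding stationary_distribution_def using p by (auto intro: pmf_eqI)
qed

text \<open>The maximisers of the density of \<open>q\<close> relative to \<open>p\<close> are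
  closed under transitions, so by irreducibility they fill \<Omega> and the density is
  constant.\<close>

lemma reversible_stationary_unique:
  assumes fin: "finite \<Omega>" and p: "set_pmf p = \<Omega>"
    and closed: "\<And>x. x \<in> \<Omega> \<Longrightarrow> set_pmf (K x) \<subseteq> \<Omega>"
    and rev: "\<And>x y. pmf p x * pmf (K x) y = pmf p y * pmf (K y) x"
    and irred: "\<And>x y. x \<in> \<Omega> \<Longrightarrow> y \<in> \<Omega> \<Longrightarrow> (x, y) \<in> {(x, y). y \<in> set_pmf (K x)}\<^sup>*"
    and q: "stationary_distribution \<Omega> K q"
  shows "q = p"
proof -
  \<comment> \<open>By reversibility the density \<open>h\<close> is harmonic, so the maximum principle applies.\<close>
  define h where "h x = pmf q x / pmf p x" for x
  have p_pos: "pmf p x > 0" if "x \<in> \<Omega>" for x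
    using that p by (simp add: pmf_positive_iff)
  have q_sub: "set_pmf q \<subseteq> \<Omega>" and q_eq: "bind_pmf q K = q"
    using q by (auto simp: stationary_distribution_def)
  have q_h: "pmf q x = h x * pmf p x" if "x \<in> \<Omega>" for x
    using p_pos[OF that] by (simp add: h_def)
  have harmonic: "h x = (\<Sum>y\<in>\<Omega>. pmf (K x) y * h y)" if x: "x \<in> \<Omega>" for x
  proof -
    have "pmf q x = (\<Sum>y\<in>\<Omega>. pmf q y * pmf (K y) x)"
      using pmf_bind_finite[OF fin q_sub, of K x] q_eq by simp
    also have "\<dots> = (\<Sum>y\<in>\<Omega>. pmf p x * (pmf (K x) y * h y))"
    proof (rule sum.cong)
      fix y assume y: "y \<in> \<Omega>"
      show "pmf q y * pmf (K y) x = pmf p x * (pmf (K x) y * h y)"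
        using arg_cong[OF rev[of y x], of "\<lambda>r. h y * r"] by (simp add: q_h[OF y] mult_ac)
    qed simp
    finally show ?thesis
      using p_pos[OF x] q_h[OF x] by (simp flip: sum_distrib_left)
  qed
  have ne: "\<Omega> \<noteq> {}" using p set_pmf_not_empty by blast
  define M where "M = Max (h ` \<Omega>)"
  have le: "h x \<le> M" if "x \<in> \<Omega>" for x
    using that fin by (simp add: M_def)
  have max_step: "h y = M" if x: "x \<in> \<Omega>" and hx: "h x = M" and y: "y \<in> set_pmf (K x)" for x y
  proof -
    have y_in: "y \<in> \<Omega>" using closed[OF x] y by blast
    \<comment> \<open>The gaps \<open>M - h y\<close> are nonnegative and have mean
      \<open>M - h x = 0\<close> under \<open>K x\<close>, so they vanish wherever
      \<open>K x\<close> has mass.\<close>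
    have "(\<Sum>y\<in>\<Omega>. pmf (K x) y * (M - h y)) = M * (\<Sum>y\<in>\<Omega>. pmf (K x) y) - h x"
      by (simp add: harmonic[OF x] right_diff_distrib sum_subtractf sum_distrib_left mult.commute[of M])
    also have "\<dots> = 0"
      by (simp add: sum_pmf_eq_1[OF fin closed[OF x]] hx)
    finally have "pmf (K x) y * (M - h y) = 0"
      using fin y_in le by (subst (asm) sum_nonneg_eq_0_iff) auto
    then show ?thesis
      using y by (simp add: pmf_eq_0_set_pmf)
  qed
  have "M \<in> h ` \<Omega>"
    unfolding M_def using fin ne by (intro Max_in) auto
  then obtain x0 where x0: "x0 \<in> \<Omega>" "h x0 = M" by auto
  have const: "h y = M" if "y \<in> \<Omega>" for y
  proof -
    have "y \<in> \<Omega> \<and> h y = M"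
      using irred[OF x0(1) that]
    proof (induction rule: rtrancl_induct)
      case (step y z)
      then show ?case using max_step[of y z] closed by blast
    qed (use x0 in simp)
    then show ?thesis by simp
  qed
  \<comment> \<open>Both measures have total mass 1, which fixes the constant density.\<close>
  have "1 = (\<Sum>x\<in>\<Omega>. pmf q x)"
    using sum_pmf_eq_1[OF fin q_sub] by simp
  also have "\<dots> = M * (\<Sum>x\<in>\<Omega>. pmf p x)"
    by (simp add: q_h const sum_distrib_left)
  also have "\<dots> = M"
    using sum_pmf_eq_1[OF fin, of p] p by simp
  finally have "M = 1" by simp
  show ?thesis
  proof (rule pmf_eqI)
    fix x show "pmf q x = pmf p x"
    proof (cases "x \<in> \<Omega>")
      case True
      then show ?thesis by (simp add: q_h const \<open>M = 1\<close>)
    next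
      case False
      then have "x \<notin> set_pmf q" "x \<notin> set_pmf p" using q_sub p by auto
      then show ?thesis by (simp add: set_pmf_iff)
    qed
  qed
qed


section \<open>Logit dynamics of exact potential games\<close>

definition exact_potential ::
  "('i::finite \<Rightarrow> 's set) \<Rightarrow> ('i \<Rightarrow> ('i \<Rightarrow> 's) \<Rightarrow> real) \<Rightarrow> (('i \<Rightarrow> 's) \<Rightarrow> real) \<Rightarrow> bool" where
  "exact_potential S u \<Phi> \<longleftrightarrow>
     (\<forall>x\<in>profiles S. \<forall>i. \<forall>y\<in>S i. u i (x(i := y)) - u i x = \<Phi> (x(i := y)) - \<Phi> x)"

definition gibbs :: "('i::finite \<Rightarrow> 's set) \<Rightarrow> (('i \<Rightarrow> 's) \<Rightarrow> real) \<Rightarrow> real \<Rightarrow> ('i \<Rightarrow> 's) pmf" where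
  "gibbs S \<Phi> \<beta> = embed_pmf (\<lambda>x. if x \<in> profiles S
     then exp (\<beta> * \<Phi> x) / (\<Sum>z\<in>profiles S. exp (\<beta> * \<Phi> z)) else 0)"

lemma fun_upd_in_profiles: "x \<in> profiles S \<Longrightarrow> y \<in> S i \<Longrightarrow> x(i := y) \<in> profiles S"
  by (simp add: profiles_def)

locale finite_game =
  fixes S :: "'i::finite \<Rightarrow> 's set" and u :: "'i \<Rightarrow> ('i \<Rightarrow> 's) \<Rightarrow> real" and \<beta> :: real
  assumes finite_S: "finite (S i)" and S_nonempty: "S i \<noteq> {}"
begin

lemma finite_profiles: "finite (profiles S)"
proof -
  have "profiles S = PiE UNIV S" by (auto simp: profiles_def PiE_def)
  then show ?thesis by (simp add: finite_PiE finite_S)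
qed

lemma profiles_nonempty: "profiles S \<noteq> {}"
proof -
  have "(\<lambda>i. SOME y. y \<in> S i) \<in> profiles S"
    using S_nonempty by (simp add: profiles_def some_in_eq)
  then show ?thesis by blast
qed

lemma sum_exp_pos: "(\<Sum>z\<in>S i. exp (g z)) > (0::real)"
  using finite_S S_nonempty by (intro sum_pos) auto

lemma partition_pos: "(\<Sum>z\<in>profiles S. exp (g z)) > (0::real)"
  using finite_profiles profiles_nonempty by (intro sum_pos) auto

text \<open>Exponentials are positive, so noise allows every strategy. Irreducibility rests on
  this.\<close>

lemma set_pmf_logit_choice: "set_pmf (logit_choice S u \<beta> i x) = S i"
  using sum_exp_pos[of "\<lambda>z. \<beta> * u i (x(i := z))" i]
  by (auto simp: set_pmf_iff pmf_logit_choice[OF finite_S S_nonempty] logit_prob_def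
           split: if_splits)

lemma set_pmf_logit_step: "set_pmf (logit_step S u \<beta> x) = (\<Union>i. (\<lambda>y. x(i := y)) ` S i)"
  by (simp add: logit_step_def set_pmf_logit_choice)

lemma logit_step_closed: "x \<in> profiles S \<Longrightarrow> set_pmf (logit_step S u \<beta> x) \<subseteq> profiles S"
  by (auto simp: set_pmf_logit_step fun_upd_in_profiles)

text \<open>Let the players switch from \<open>x\<close> to \<open>y\<close> one at a time; in the
  induction, \<open>A\<close> is the set of players who have switched.\<close>

lemma logit_step_irreducible:
  assumes x: "x \<in> profiles S" and y: "y \<in> profiles S"
  shows "(x, y) \<in> {(x, y). y \<in> set_pmf (logit_step S u \<beta> x)}\<^sup>*"
proof -
  let ?R = "{(x, y). y \<in> set_pmf (logit_step S u \<beta> x)}"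
  have "(x, \<lambda>i. if i \<in> A then y i else x i) \<in> ?R\<^sup>*" if "finite A" for A
    using that
  proof (induction A)
    case (insert i A)
    let ?z = "\<lambda>i. if i \<in> A then y i else x i"
    have upd: "(\<lambda>j. if j \<in> insert i A then y j else x j) = ?z(i := y i)" by auto
    have "(?z, ?z(i := y i)) \<in> ?R"
      using y unfolding mem_Collect_eq case_prod_conv set_pmf_logit_step
      by (intro UN_I[of i] imageI) (simp_all add: profiles_def)
    with insert.IH show ?case unfolding upd by (rule rtrancl.rtrancl_into_rtrancl)
  qed simp
  from this[of UNIV] show ?thesis by simp
qed

text \<open>The sum over players remains because for \<open>z = x\<close> every player can
  contribute; if \<open>z\<close> differs from \<open>x\<close> in one coordinate, only that player
  can.\<close>

lemma pmf_logit_step: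
  "pmf (logit_step S u \<beta> x) z =
     (\<Sum>i\<in>UNIV. if x(i := z i) = z \<and> z i \<in> S i then logit_prob S u \<beta> i x (z i) else 0) / CARD('i)"
proof -
  have "pmf (map_pmf (\<lambda>y. x(i := y)) (logit_choice S u \<beta> i x)) z =
      (if x(i := z i) = z \<and> z i \<in> S i then logit_prob S u \<beta> i x (z i) else 0)" for i
  proof (cases "x(i := z i) = z")
    case True
    have "inj (\<lambda>y. x(i := y))" by (auto intro!: injI dest: fun_upd_eqD)
    then have "pmf (map_pmf (\<lambda>y. x(i := y)) (logit_choice S u \<beta> i x)) (x(i := z i)) =
        pmf (logit_choice S u \<beta> i x) (z i)"
      by (rule pmf_map_inj')
    with True show ?thesis by (simp add: pmf_logit_choice[OF finite_S S_nonempty])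
  next
    case False
    then have "z \<notin> range (\<lambda>y. x(i := y))" by auto
    then have "z \<notin> set_pmf (map_pmf (\<lambda>y. x(i := y)) (logit_choice S u \<beta> i x))"
      unfolding set_map_pmf by blast
    then have "pmf (map_pmf (\<lambda>y. x(i := y)) (logit_choice S u \<beta> i x)) z = 0"
      by (simp only: set_pmf_iff not_not)
    then show ?thesis using False by simp
  qed
  then show ?thesis
    unfolding logit_step_def by (simp add: pmf_bind integral_pmf_of_set)
qed

section \<open>The Gibbs measure: detailed balance and stationarity\<close>

lemma pmf_gibbs:
  "pmf (gibbs S \<Phi> \<beta>) x = (if x \<in> profiles S
     then exp (\<beta> * \<Phi> x) / (\<Sum>z\<in>profiles S. exp (\<beta> * \<Phi> z)) else 0)"
proof -
  let ?Z = "\<Sum>z\<in>profiles S. exp (\<beta> * \<Phi> z)"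
  let ?f = "\<lambda>x. if x \<in> profiles S then exp (\<beta> * \<Phi> x) / ?Z else 0"
  have pos: "?Z > 0" by (rule partition_pos)
  then have nonneg: "?f z \<ge> 0" for z by auto
  have "(\<integral>\<^sup>+ z. ennreal (?f z) \<partial>count_space UNIV) = (\<Sum>z\<in>profiles S. ennreal (?f z))"
    using finite_profiles by (intro nn_integral_count_space') auto
  also have "\<dots> = ennreal (\<Sum>z\<in>profiles S. ?f z)"
    by (rule sum_ennreal) (use nonneg in blast)
  also have "(\<Sum>z\<in>profiles S. ?f z) = 1"
    using pos by (simp flip: sum_divide_distrib)
  finally show ?thesis
    unfolding gibbs_def using nonneg by (subst pmf_embed_pmf) auto
qed

lemma set_pmf_gibbs: "set_pmf (gibbs S \<Phi> \<beta>) = profiles S"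
  using partition_pos[of "\<lambda>z. \<beta> * \<Phi> z"] by (auto simp: set_pmf_iff pmf_gibbs split: if_splits)

text \<open>Detailed balance holds for each player separately: an exact potential makes the ratio of
  Gibbs weights equal to that of the logit numerators.\<close>

lemma gibbs_reversible:
  assumes \<Phi>: "exact_potential S u \<Phi>"
  shows "pmf (gibbs S \<Phi> \<beta>) x * pmf (logit_step S u \<beta> x) z =
         pmf (gibbs S \<Phi> \<beta>) z * pmf (logit_step S u \<beta> z) x"
proof -
  let ?t = "\<lambda>x z i. if x(i := z i) = z \<and> z i \<in> S i then logit_prob S u \<beta> i x (z i) else 0"
  have "pmf (gibbs S \<Phi> \<beta>) x * ?t x z i = pmf (gibbs S \<Phi> \<beta>) z * ?t z x i" for i
  proof (cases "x(i := z i) = z \<and> x \<in> profiles S \<and> z \<in> profiles S")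
    case True
    then have z: "x(i := z i) = z" and mem: "x \<in> profiles S" "z \<in> profiles S" by auto
    \<comment> \<open>\<open>x\<close> and \<open>z\<close> agree off \<open>i\<close>, so both
      directions share the logit denominator, which cancels.\<close>
    have same: "x(i := s) = z(i := s)" for s by (subst z[symmetric]) simp
    have x: "z(i := x i) = x" by (simp flip: same)
    have mem_S: "x i \<in> S i" "z i \<in> S i" using mem by (auto simp: profiles_def)
    have "u i (x(i := z i)) - u i x = \<Phi> (x(i := z i)) - \<Phi> x"
      using \<Phi> mem(1) mem_S(2) unfolding exact_potential_def by blast
    then have "\<beta> * (\<Phi> x + u i z) = \<beta> * (\<Phi> z + u i x)" by (simp add: z)
    then have "exp (\<beta> * \<Phi> x) * exp (\<beta> * u i z) = exp (\<beta> * \<Phi> z) * exp (\<beta> * u i x)"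
      by (simp add: distrib_left flip: exp_add)
    then show ?thesis
      unfolding logit_prob_def same using mem mem_S by (simp add: x pmf_gibbs)
  next
    case False
    \<comment> \<open>A possible move between \<open>x\<close> and \<open>z\<close> is possible both
      ways and stays among the profiles, so here both sides are 0.\<close>
    have upd_sym: "x(i := z i) = z \<longleftrightarrow> z(i := x i) = x" by (auto simp: fun_eq_iff)
    have "pmf (gibbs S \<Phi> \<beta>) x * ?t x z i = 0"
      using False fun_upd_in_profiles[of x S "z i" i] by (auto simp: pmf_gibbs)
    moreover have "pmf (gibbs S \<Phi> \<beta>) z * ?t z x i = 0"
      using False fun_upd_in_profiles[of z S "x i" i] upd_sym by (auto simp: pmf_gibbs)
    ultimately show ?thesis by (simp only:)
  qed
  then show ?thesis
    by (simp only: pmf_logit_step times_divide_eq_right sum_distrib_left)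
qed

lemma logit_stationary_eq_gibbs:
  assumes "exact_potential S u \<Phi>"
  shows "logit_stationary S u \<beta> = gibbs S \<Phi> \<beta>"
  unfolding logit_stationary_def
proof (rule the_equality)
  show "stationary_distribution (profiles S) (logit_step S u \<beta>) (gibbs S \<Phi> \<beta>)"
    using finite_profiles logit_step_closed gibbs_reversible[OF assms]
    by (intro reversible_imp_stationary) (auto simp: set_pmf_gibbs)
  show "p = gibbs S \<Phi> \<beta>" if "stationary_distribution (profiles S) (logit_step S u \<beta>) p" for p
    using finite_profiles set_pmf_gibbs logit_step_closed gibbs_reversible[OF assms]
      logit_step_irreducible that
    by (rule reversible_stationary_unique)
qed

lemma stationary_expected_welfare_potential:
  assumes "exact_potential S u \<Phi>"
  shows "stationary_expected_welfare S u \<beta> =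
    (\<Sum>x\<in>profiles S. exp (\<beta> * \<Phi> x) * social_welfare u x) / (\<Sum>x\<in>profiles S. exp (\<beta> * \<Phi> x))"
  unfolding stationary_expected_welfare_def logit_stationary_eq_gibbs[OF assms]
  using finite_profiles
  by (subst integral_measure_pmf_real[of "profiles S"])
     (auto simp: set_pmf_gibbs pmf_gibbs sum_divide_distrib mult.commute)

end


section \<open>The CK game\<close>

lemma UNIV_facility: "UNIV = range G \<union> range H"
proof -
  have "f \<in> range G \<union> range H" for f by (cases f) auto
  then show ?thesis by blast
qed

text \<open>A sum over an infinite set would default to 0; the sums over all facilities rely on
  this.\<close>

lemma finite_facilities [simp]: "finite (A :: facility set)"
  by (rule finite_subset[OF subset_UNIV]) (simp add: UNIV_facility)

lemma sum_facility:
  "(\<Sum>f\<in>UNIV. g f) = (\<Sum>i\<in>UNIV. g (G i)) + (\<Sum>i\<in>UNIV. g (H i) :: real)"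
  unfolding UNIV_facility
  by (subst sum.union_disjoint) (auto simp: sum.reindex inj_on_def)

text \<open>The term \<open>c * (c + 1) / 2\<close> is \<open>1 + ... + c\<close>, the costs met by
  users arriving one after another.\<close>

definition ck_potential :: "(3 \<Rightarrow> nat) \<Rightarrow> real" where
  "ck_potential x = - (\<Sum>f\<in>UNIV. real (ck_cost x f) * (real (ck_cost x f) + 1) / 2)"

text \<open>Isolates the part of the cost that a deviation of \<open>i\<close> cannot
  change.\<close>

lemma ck_cost_remove:
  "real (ck_cost x f) =
     real (card {j. j \<noteq> i \<and> f \<in> ck_select j (x j)}) + of_bool (f \<in> ck_select i (x i))"
proof -
  have "{j. f \<in> ck_select j (x j)} =
      (if f \<in> ck_select i (x i) then insert i else id) {j. j \<noteq> i \<and> f \<in> ck_select j (x j)}"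
    by auto
  then show ?thesis by (simp add: ck_cost_def)
qed

text \<open>Rosenthal's argument: the potential minus the utility of player \<open>i\<close> is the
  potential of the game in which \<open>i\<close> is absent.\<close>

lemma ck_exact_potential: "exact_potential ck_strategies ck_utility ck_potential"
proof -
  define c where "c x i f = real (card {j. j \<noteq> i \<and> f \<in> ck_select j (x j)})"
    for x :: "3 \<Rightarrow> nat" and i f
  have diff: "ck_potential x - ck_utility i x = - (\<Sum>f\<in>UNIV. c x i f * (c x i f + 1) / 2)" for x i
  proof -
    have utility: "ck_utility i x =
        - (\<Sum>f\<in>UNIV. of_bool (f \<in> ck_select i (x i)) * real (ck_cost x f))"
      unfolding ck_utility_def
      by (subst sum.mono_neutral_cong_right[of UNIV "ck_select i (x i)"]) auto
    have cost: "real (ck_cost x f) = c x i f + of_bool (f \<in> ck_select i (x i))" for f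
      unfolding c_def by (rule ck_cost_remove)
    \<comment> \<open>When \<open>i\<close> joins \<open>c\<close> other users, the triangular
      number grows by \<open>c + 1\<close>, exactly what \<open>i\<close> pays.\<close>
    have "real (ck_cost x f) * (real (ck_cost x f) + 1) / 2 =
        c x i f * (c x i f + 1) / 2 + of_bool (f \<in> ck_select i (x i)) * real (ck_cost x f)" for f
      unfolding cost by (cases "f \<in> ck_select i (x i)") (simp_all add: field_simps)
    then show ?thesis
      unfolding ck_potential_def utility by (simp only: sum.distrib)
  qed
  have "c (x(i := y)) i = c x i" for x i y
  proof
    fix f
    have "{j. j \<noteq> i \<and> f \<in> ck_select j ((x(i := y)) j)} = {j. j \<noteq> i \<and> f \<in> ck_select j (x j)}"
      by auto
    then show "c (x(i := y)) i f = c x i f" by (simp only: c_def)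
  qed
  then have "ck_potential (x(i := y)) - ck_utility i (x(i := y)) = ck_potential x - ck_utility i x"
    for x i y
    by (simp only: diff)
  then show ?thesis
    unfolding exact_potential_def by (simp add: algebra_simps)
qed

lemma ck_cost_eq_sum: "real (ck_cost x f) = (\<Sum>i\<in>UNIV. of_bool (f \<in> ck_select i (x i)))"
  by (simp add: ck_cost_def)

text \<open>Double counting: each of the \<open>c\<close> users of a facility pays
  \<open>c\<close>.\<close>

lemma ck_social_welfare: "social_welfare ck_utility x = - (\<Sum>f\<in>UNIV. (real (ck_cost x f))\<^sup>2)"
proof -
  have "(\<Sum>i\<in>UNIV. \<Sum>f\<in>ck_select i (x i). real (ck_cost x f)) =
      (\<Sum>i\<in>UNIV. \<Sum>f\<in>UNIV. of_bool (f \<in> ck_select i (x i)) * real (ck_cost x f))"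
    by (intro sum.cong refl sum.mono_neutral_cong_left) auto
  also have "\<dots> = (\<Sum>f\<in>UNIV. \<Sum>i\<in>UNIV. of_bool (f \<in> ck_select i (x i)) * real (ck_cost x f))"
    by (rule sum.swap)
  also have "\<dots> = (\<Sum>f\<in>UNIV. (real (ck_cost x f))\<^sup>2)"
    by (simp only: ck_cost_eq_sum power2_eq_square flip: sum_distrib_right)
  finally show ?thesis
    by (simp add: social_welfare_def ck_utility_def sum_negf)
qed

section \<open>Enumeration and evaluation of the eight profiles\<close>

definition ck_profile :: "nat \<Rightarrow> nat \<Rightarrow> nat \<Rightarrow> 3 \<Rightarrow> nat" where
  "ck_profile a b c i = (if i = 0 then a else if i = 1 then b else c)"

lemma sum_ck_profiles:
  "(\<Sum>x\<in>profiles ck_strategies. g x) =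
     (\<Sum>a\<in>{0, 1}. \<Sum>b\<in>{0, 1}. \<Sum>c\<in>{0, 1}. g (ck_profile a b c) :: real)"
proof -
  have "(\<Sum>x\<in>profiles ck_strategies. g x) =
      (\<Sum>(a, b, c)\<in>{0, 1} \<times> {0, 1} \<times> {0, 1}. g (ck_profile a b c))"
  proof (rule sum.reindex_bij_witness[where i = "\<lambda>(a, b, c). ck_profile a b c"
        and j = "\<lambda>x. (x 0, x 1, x 2)"])
    fix x :: "3 \<Rightarrow> nat"
    show eq: "(case (x 0, x 1, x 2) of (a, b, c) \<Rightarrow> ck_profile a b c) = x"
    proof
      fix i :: 3
      show "(case (x 0, x 1, x 2) of (a, b, c) \<Rightarrow> ck_profile a b c) i = x i"
        using exhaust_3[of i] by (auto simp: ck_profile_def)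
    qed
    then show "(case (x 0, x 1, x 2) of (a, b, c) \<Rightarrow> g (ck_profile a b c)) = g x" by simp
    assume "x \<in> profiles ck_strategies"
    then have "x i \<in> {0, 1}" for i by (simp add: profiles_def ck_strategies_def)
    then show "(x 0, x 1, x 2) \<in> {0, 1} \<times> {0, 1} \<times> {0, 1}" by blast
  next
    fix t :: "nat \<times> nat \<times> nat"
    assume t: "t \<in> {0, 1} \<times> {0, 1} \<times> {0, 1}"
    obtain a b c where abc: "t = (a, b, c)" by (cases t)
    have mem: "a \<in> {0, 1}" "b \<in> {0, 1}" "c \<in> {0, 1}" using t unfolding abc by blast+
    show "(case t of (a, b, c) \<Rightarrow> ck_profile a b c) \<in> profiles ck_strategies"
      using mem by (simp add: abc profiles_def ck_strategies_def ck_profile_def)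
    show "((case t of (a, b, c) \<Rightarrow> ck_profile a b c) 0, (case t of (a, b, c) \<Rightarrow> ck_profile a b c) 1,
        (case t of (a, b, c) \<Rightarrow> ck_profile a b c) 2) = t"
      by (simp add: abc ck_profile_def)
  qed
  then show ?thesis by (simp add: sum.cartesian_product)
qed

text \<open>Inverts \<open>ck_select\<close>: under strategy 1, \<open>G j\<close> is chosen by
  player \<open>j - 1\<close>, and \<open>H j\<close> by players \<open>j + 1\<close> and
  \<open>j - 1\<close>.\<close>

lemma ck_cost_simps:
  "real (ck_cost x (G j)) = of_bool (x j = 0) + of_bool (x (j - 1) \<noteq> 0)"
  "real (ck_cost x (H j)) =
     of_bool (x j = 0) + of_bool (x (j + 1) \<noteq> 0) + of_bool (x (j - 1) \<noteq> 0)"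
proof -
  have wrap: "(3::3) = 0" "(4::3) = 1" "(- 1::3) = 2" by simp_all
  show "real (ck_cost x (G j)) = of_bool (x j = 0) + of_bool (x (j - 1) \<noteq> 0)"
    "real (ck_cost x (H j)) =
       of_bool (x j = 0) + of_bool (x (j + 1) \<noteq> 0) + of_bool (x (j - 1) \<noteq> 0)"
    using exhaust_3[of j] by (auto simp: ck_cost_eq_sum sum_3 ck_select_def wrap)
qed

theorem theorem6:
  fixes \<beta> :: real
  assumes "\<beta> \<ge> 0"
  shows "stationary_expected_welfare ck_strategies ck_utility \<beta> =
    - ((6 + 39 * exp (- 4 * \<beta>) + 63 * exp (- 6 * \<beta>)) /
       (1 + 3 * exp (- 4 * \<beta>) + 4 * exp (- 6 * \<beta>)))"
proof -
  interpret finite_game ck_strategies ck_utility \<beta>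
    by standard (auto simp: ck_strategies_def)
  let ?e = "\<lambda>n. exp (- n * \<beta>)"
  \<comment> \<open>With 0, 1, 2, 3 players on strategy 1 there are 1, 3, 3, 1 profiles, with
    potentials -6, -10, -12, -12 and welfare -6, -13, -16, -15. Hence 39 = 3 * 13, 63 = 3 * 16 + 15
    and the 4 in the denominator.\<close>
  have num: "(\<Sum>x\<in>profiles ck_strategies. exp (\<beta> * ck_potential x) * social_welfare ck_utility x) =
      - (6 * ?e 6 + 39 * ?e 10 + 63 * ?e 12)"
    by (simp add: sum_ck_profiles ck_social_welfare ck_potential_def sum_facility sum_3
        ck_cost_simps ck_profile_def mult.commute)
  have den: "(\<Sum>x\<in>profiles ck_strategies. exp (\<beta> * ck_potential x)) = ?e 6 + 3 * ?e 10 + 4 * ?e 12"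
    by (simp add: sum_ck_profiles ck_potential_def sum_facility sum_3
        ck_cost_simps ck_profile_def mult.commute)
  \<comment> \<open>The weight of the all-zero profile is factored out and cancels, lowering the
    exponents 10 and 12 to 4 and 6.\<close>
  have e: "?e 10 = ?e 6 * ?e 4" "?e 12 = ?e 6 * ?e 6"
    by (simp_all flip: exp_add)
  have "stationary_expected_welfare ck_strategies ck_utility \<beta> =
      (?e 6 * - (6 + 39 * ?e 4 + 63 * ?e 6)) / (?e 6 * (1 + 3 * ?e 4 + 4 * ?e 6))"
    unfolding stationary_expected_welfare_potential[OF ck_exact_potential] num den e
    by (simp add: algebra_simps)
  then show ?thesis
    by (simp only: mult_divide_mult_cancel_left_if exp_not_eq_zero if_False minus_divide_left)
qed

end
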